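(* Let $n\ge 1$, let $N$ be an $n$-dimensional $C^\infty$ manifold without boundary, let $(f,\nu): N\to\mathbb{R}^{n+1}\times S^n$ be a frontal and let $x_0$ be a point of $N$. Then, for any point $P\in\mathbb{R}^{n+1}$ such that $(f(x_0)-P)\cdot\nu(x_0)\neq 0$, the following are equivalent, where $(\widetilde f,\widetilde\nu): (N,x_0)\to\mathbb{R}^{n+1}\times S^n$ is the anti-orthotomic germ of $f$ relative to $P$: (1) $(f,\nu): (N,x_0)\to\mathbb{R}^{n+1}\times S^n$ is a front-germ. (2) $(\widetilde f,\widetilde\nu): (N,x_0)\to\mathbb{R}^{n+1}\times S^n$ is a front-germ. (3) $(f,\widetilde f): (N,x_0)\to\mathbb{R}^{n+1}\times\mathbb{R}^{n+1}$ is non-singular.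
   Context: All mappings are of class $C^\infty$; $S^n\subset\mathbb{R}^{n+1}$ is the unit sphere and $\cdot$ the Euclidean scalar product. A mapping $f:N\to\mathbb{R}^{n+1}$ is a frontal if there is a mapping $\nu:N\to S^n$ (its Gauss mapping) with $df_x(\mathbf v)\cdot\nu(x)=0$ for all $x\in N$, $\mathbf v\in T_xN$; the pair $(f,\nu)$ is also called a frontal (similarly for germs). Near $x_0$ the condition $(f(x)-P)\cdot\nu(x)\ne 0$ holds, and the anti-orthotomic germ of $f$ relative to $P$ is the frontal-germ given by $\widetilde f(x)=f(x)-\frac{\|f(x)-P\|^2}{2(f(x)-P)\cdot\nu(x)}\nu(x)$ and $\widetilde\nu(x)=\frac{f(x)-P}{\|f(x)-P\|}$. A map-germ at $x_0$ from $N$ is non-singular if its differential at $x_0$ has rank $n=\dim N$ (i.e. is injective). A germ of frontal $(f,\nu):(N,x_0)\to\mathbb{R}^{n+1}\times S^n$ is a front-germ if $(f,\nu)$ is non-singular at $x_0$. *)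

theory Defs
  imports "HOL-Analysis.Analysis"
begin

text \<open>
  \<open>f\<close> is of class \<open>C\<^sup>k\<close>: its iterated directional derivatives up to order \<open>k\<close> exist and
  are continuous. Meant for open \<open>S\<close> only, since \<open>frechet_derivative f (at x)\<close> is the
  derivative with respect to full neighbourhoods.
\<close>

primrec Ck_on ::
  "nat \<Rightarrow> ('a::real_normed_vector \<Rightarrow> 'b::real_normed_vector) \<Rightarrow> 'a set \<Rightarrow> bool" where
  "Ck_on 0 f S \<longleftrightarrow> continuous_on S f"
| "Ck_on (Suc k) f S \<longleftrightarrow>
     (\<forall>x\<in>S. f differentiable (at x)) \<and>
     (\<forall>v. Ck_on k (\<lambda>x. frechet_derivative f (at x) v) S)"

definition Cinf_on :: "('a::real_normed_vector \<Rightarrow> 'b::real_normed_vector) \<Rightarrow> 'a set \<Rightarrow> bool" where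
  "Cinf_on f S \<longleftrightarrow> (\<forall>k. Ck_on k f S)"


text \<open>A chart is its domain together with its coordinate map, whose values matter on the domain
  only.\<close>

type_synonym ('a, 'n) chart = "'a set \<times> ('a \<Rightarrow> real ^ 'n)"

abbreviation chart_dom :: "('a, 'n) chart \<Rightarrow> 'a set" where
  "chart_dom \<equiv> fst"

abbreviation coords :: "('a, 'n) chart \<Rightarrow> 'a \<Rightarrow> real ^ 'n" where
  "coords \<equiv> snd"

definition param :: "('a, 'n) chart \<Rightarrow> real ^ 'n \<Rightarrow> 'a" where
  "param c = inv_into (chart_dom c) (coords c)"

definition is_chart :: "'a topology \<Rightarrow> ('a, 'n::finite) chart \<Rightarrow> bool" where
  "is_chart X c \<longleftrightarrow>
     openin X (chart_dom c) \<and>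
     open (coords c ` chart_dom c) \<and>
     homeomorphic_map (subtopology X (chart_dom c))
       (top_of_set (coords c ` chart_dom c)) (coords c)"

text \<open>The atlas need not be maximal; the notions below are the same for an atlas and for the
  maximal atlas it generates. The dimension of the manifold is \<open>CARD('n)\<close>.\<close>

definition smooth_manifold :: "'a topology \<Rightarrow> ('a, 'n::finite) chart set \<Rightarrow> bool" where
  "smooth_manifold X A \<longleftrightarrow>
     Hausdorff_space X \<and> second_countable X \<and>
     (\<forall>c\<in>A. is_chart X c) \<and>
     (\<Union>c\<in>A. chart_dom c) = topspace X \<and>
     (\<forall>c\<in>A. \<forall>c'\<in>A.
        Cinf_on (coords c' \<circ> param c) (coords c ` (chart_dom c \<inter> chart_dom c')))"

definition smooth_map_on ::
  "('a, 'n::finite) chart set \<Rightarrow> 'a set \<Rightarrow> ('a \<Rightarrow> 'b::real_normed_vector) \<Rightarrow> bool" where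
  "smooth_map_on A U g \<longleftrightarrow>
     (\<forall>c\<in>A. Cinf_on (g \<circ> param c) (coords c ` (chart_dom c \<inter> U)))"

definition charts_at :: "('a, 'n::finite) chart set \<Rightarrow> 'a \<Rightarrow> ('a, 'n) chart set" where
  "charts_at A x = {c \<in> A. x \<in> chart_dom c}"

text \<open>
  A tangent vector at \<open>x\<close> is the family of its coordinate vectors in the charts around \<open>x\<close>, any two
  of which are related by the derivative of the transition map (and, to make the
  representation unique, it is 0 at all other charts).
\<close>

definition tangent_space ::
  "('a, 'n::finite) chart set \<Rightarrow> 'a \<Rightarrow> (('a, 'n) chart \<Rightarrow> real ^ 'n) set" where
  "tangent_space A x =
     {v. (\<forall>c\<in>charts_at A x. \<forall>c'\<in>charts_at A x.
            v c' = frechet_derivative (coords c' \<circ> param c) (at (coords c x)) (v c)) \<and>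
         (\<forall>c. c \<notin> charts_at A x \<longrightarrow> v c = 0)}"

text \<open>The choice of the chart is immaterial for \<open>g\<close> differentiable at \<open>x\<close>, by the chain rule;
  see \<open>differential_eq\<close> below.\<close>

definition differential ::
  "('a, 'n::finite) chart set \<Rightarrow> ('a \<Rightarrow> 'b::real_normed_vector) \<Rightarrow> 'a
     \<Rightarrow> (('a, 'n) chart \<Rightarrow> real ^ 'n) \<Rightarrow> 'b" where
  "differential A g x v =
     (let c = (SOME c. c \<in> charts_at A x)
      in frechet_derivative (g \<circ> param c) (at (coords c x)) (v c))"

lemma param_coords: "is_chart X c \<Longrightarrow> x \<in> chart_dom c \<Longrightarrow> param c (coords c x) = x"
  unfolding is_chart_def param_def homeomorphic_map_def
  by (metis inf.absorb_iff2 inv_into_f_f openin_subset topspace_subtopology)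

lemma open_coords_image:
  assumes c: "is_chart X c" and U: "openin X U"
  shows "open (coords c ` (chart_dom c \<inter> U))"
proof -
  have "openin (subtopology X (chart_dom c)) (chart_dom c \<inter> U)"
    using U by (metis inf_commute openin_subtopology_Int)
  then have "openin (top_of_set (coords c ` chart_dom c)) (coords c ` (chart_dom c \<inter> U))"
    using c unfolding is_chart_def
    by (metis homeomorphic_imp_open_map open_map_def)
  then show ?thesis
    using c unfolding is_chart_def by (metis openin_open_trans)
qed

lemma frechet_derivative_change_chart:
  assumes M: "smooth_manifold X A" and c: "c \<in> charts_at A x" and c': "c' \<in> charts_at A x"
    and g: "(g \<circ> param c') differentiable (at (coords c' x))"
  shows "frechet_derivative (g \<circ> param c) (at (coords c x)) =
    frechet_derivative (g \<circ> param c') (at (coords c' x)) \<circ>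
    frechet_derivative (coords c' \<circ> param c) (at (coords c x))"
proof -
  let ?S = "coords c ` (chart_dom c \<inter> chart_dom c')"
  let ?t = "coords c' \<circ> param c"
  have ch: "is_chart X c" "is_chart X c'" and x: "x \<in> chart_dom c" "x \<in> chart_dom c'"
    using M c c' by (auto simp: smooth_manifold_def charts_at_def)
  have S: "open ?S" "coords c x \<in> ?S"
    using open_coords_image[OF ch(1), of "chart_dom c'"] ch(2) x by (auto simp: is_chart_def)
  have "Ck_on (Suc 0) ?t ?S"
    using M c c' by (auto simp: smooth_manifold_def charts_at_def Cinf_on_def simp del: Ck_on.simps)
  then have t: "?t differentiable (at (coords c x))"
    using S(2) by auto
  have tx: "?t (coords c x) = coords c' x"
    using param_coords[OF ch(1) x(1)] by simp
  have "frechet_derivative ((g \<circ> param c') \<circ> ?t) (at (coords c x)) =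
        frechet_derivative (g \<circ> param c) (at (coords c x))"
  proof (rule frechet_derivative_transform_within_open[OF _ S])
    show "((g \<circ> param c') \<circ> ?t) differentiable (at (coords c x))"
      using differentiable_chain_at[OF t, of "g \<circ> param c'"] g tx by simp
    show "((g \<circ> param c') \<circ> ?t) y = (g \<circ> param c) y" if "y \<in> ?S" for y
      using that param_coords[OF ch(1)] param_coords[OF ch(2)] by auto
  qed
  with frechet_derivative_compose[OF t, of "g \<circ> param c'"] g tx show ?thesis
    by simp
qed

lemma differential_eq:
  assumes M: "smooth_manifold X A" and c: "c \<in> charts_at A x" and v: "v \<in> tangent_space A x"
    and g: "\<And>c. c \<in> charts_at A x \<Longrightarrow> (g \<circ> param c) differentiable (at (coords c x))"
  shows "differential A g x v = frechet_derivative (g \<circ> param c) (at (coords c x)) (v c)"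
proof -
  define d where "d = (SOME c. c \<in> charts_at A x)"
  have d: "d \<in> charts_at A x"
    unfolding d_def using c by (rule someI)
  have "v c = frechet_derivative (coords c \<circ> param d) (at (coords d x)) (v d)"
    using v c d unfolding tangent_space_def by blast
  then show ?thesis
    using frechet_derivative_change_chart[OF M d c g[OF c]]
    by (simp add: differential_def flip: d_def)
qed

text \<open>Every chart around \<open>x\<close> identifies the tangent space at \<open>x\<close> with \<open>real ^ 'n\<close>.\<close>

lemma bij_betw_tangent_space:
  fixes A :: "('a, 'n::finite) chart set"
  assumes M: "smooth_manifold X A" and c: "c \<in> charts_at A x"
  shows "bij_betw (\<lambda>v. v c) (tangent_space A x) UNIV"
proof -
  let ?D = "\<lambda>c c'. frechet_derivative (coords c' \<circ> param c) (at (coords c x))"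
  have diff: "(coords c' \<circ> param c) differentiable (at (coords c x))"
    if "c \<in> charts_at A x" "c' \<in> charts_at A x" for c c'
  proof -
    have "Ck_on (Suc 0) (coords c' \<circ> param c) (coords c ` (chart_dom c \<inter> chart_dom c'))"
      using M that
      by (auto simp: smooth_manifold_def charts_at_def Cinf_on_def simp del: Ck_on.simps)
    then show ?thesis
      using that by (auto simp: charts_at_def)
  qed
  have ident: "?D c c w = w" for w
  proof -
    have ch: "is_chart X c" and x: "x \<in> chart_dom c"
      using M c by (auto simp: smooth_manifold_def charts_at_def)
    have "frechet_derivative (\<lambda>y. y) (at (coords c x)) = ?D c c"
      by (rule frechet_derivative_transform_within_open[of _ _ "coords c ` chart_dom c"])
        (use ch x param_coords[OF ch] in \<open>auto simp: is_chart_def\<close>)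
    then show ?thesis
      by (metis frechet_derivative_ident)
  qed
  have inj: "inj_on (\<lambda>v. v c) (tangent_space A x)"
  proof (rule inj_onI)
    fix v w assume v: "v \<in> tangent_space A x" and w: "w \<in> tangent_space A x" and eq: "v c = w c"
    have "v c' = ?D c c' (v c)" "w c' = ?D c c' (w c)" if "c' \<in> charts_at A x" for c'
      using v w c that unfolding tangent_space_def by blast+
    moreover have "v c' = 0" "w c' = 0" if "c' \<notin> charts_at A x" for c'
      using v w that unfolding tangent_space_def by blast+
    ultimately show "v = w"
      using eq by (metis ext)
  qed
  have "w \<in> (\<lambda>v. v c) ` tangent_space A x" for w
  proof -
    let ?v = "\<lambda>c'. if c' \<in> charts_at A x then ?D c c' w else 0"
    have v: "w = ?v c"
      using c ident by simp
    have "?D c' c'' (?D c c' w) = ?D c c'' w"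
      if "c' \<in> charts_at A x" "c'' \<in> charts_at A x" for c' c''
      using frechet_derivative_change_chart[OF M c that(1) diff[OF that]] by simp
    then have "?v \<in> tangent_space A x"
      by (simp add: tangent_space_def)
    with v show ?thesis
      by (rule image_eqI[where x = ?v])
  qed
  with inj show ?thesis
    by (auto simp: bij_betw_def)
qed

text \<open>
  In the following, a germ at \<open>x\<close> is given by any function that represents it near \<open>x\<close>; its values
  elsewhere are irrelevant.
\<close>

definition smooth_germ ::
  "'a topology \<Rightarrow> ('a, 'n::finite) chart set \<Rightarrow> ('a \<Rightarrow> 'b::real_normed_vector) \<Rightarrow> 'a \<Rightarrow> bool" where
  "smooth_germ X A g x \<longleftrightarrow> (\<exists>U. openin X U \<and> x \<in> U \<and> smooth_map_on A U g)"

definition nonsingular_germ ::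
  "'a topology \<Rightarrow> ('a, 'n::finite) chart set \<Rightarrow> ('a \<Rightarrow> 'b::euclidean_space) \<Rightarrow> 'a \<Rightarrow> bool" where
  "nonsingular_germ X A g x \<longleftrightarrow>
     smooth_germ X A g x \<and> dim (differential A g x ` tangent_space A x) = CARD('n)"


text \<open>The ambient space is \<open>real ^ 'm\<close>, to be used with \<open>CARD('m) = CARD('n) + 1\<close>. A smooth map
  to the unit sphere is a smooth map to \<open>real ^ 'm\<close> with values in the sphere.\<close>

definition frontal_on ::
  "('a, 'n::finite) chart set \<Rightarrow> 'a set \<Rightarrow> ('a \<Rightarrow> real ^ 'm) \<Rightarrow> ('a \<Rightarrow> real ^ 'm) \<Rightarrow> bool" where
  "frontal_on A U f \<nu> \<longleftrightarrow>
     smooth_map_on A U f \<and> smooth_map_on A U \<nu> \<and>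
     (\<forall>x\<in>U. \<nu> x \<in> sphere 0 1) \<and>
     (\<forall>x\<in>U. \<forall>v\<in>tangent_space A x. differential A f x v \<bullet> \<nu> x = 0)"

definition frontal ::
  "'a topology \<Rightarrow> ('a, 'n::finite) chart set \<Rightarrow> ('a \<Rightarrow> real ^ 'm) \<Rightarrow> ('a \<Rightarrow> real ^ 'm) \<Rightarrow> bool" where
  "frontal X A f \<nu> \<longleftrightarrow> frontal_on A (topspace X) f \<nu>"

definition frontal_germ ::
  "'a topology \<Rightarrow> ('a, 'n::finite) chart set \<Rightarrow> ('a \<Rightarrow> real ^ 'm) \<Rightarrow> ('a \<Rightarrow> real ^ 'm)
     \<Rightarrow> 'a \<Rightarrow> bool" where
  "frontal_germ X A f \<nu> x \<longleftrightarrow> (\<exists>U. openin X U \<and> x \<in> U \<and> frontal_on A U f \<nu>)"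

definition front_germ ::
  "'a topology \<Rightarrow> ('a, 'n::finite) chart set \<Rightarrow> ('a \<Rightarrow> real ^ 'm) \<Rightarrow> ('a \<Rightarrow> real ^ 'm)
     \<Rightarrow> 'a \<Rightarrow> bool" where
  "front_germ X A f \<nu> x \<longleftrightarrow>
     frontal_germ X A f \<nu> x \<and> nonsingular_germ X A (\<lambda>y. (f y, \<nu> y)) x"

text \<open>Meaningful only near points \<open>x\<close> with \<open>(f x - P) \<bullet> \<nu> x \<noteq> 0\<close>.\<close>

definition anti_orthotomic ::
  "real ^ 'm \<Rightarrow> ('a \<Rightarrow> real ^ 'm) \<Rightarrow> ('a \<Rightarrow> real ^ 'm) \<Rightarrow> 'a \<Rightarrow> real ^ 'm" where
  "anti_orthotomic P f \<nu> x =
     f x - ((norm (f x - P))\<^sup>2 / (2 * ((f x - P) \<bullet> \<nu> x))) *\<^sub>R \<nu> x"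

definition anti_orthotomic_gauss ::
  "real ^ 'm \<Rightarrow> ('a \<Rightarrow> real ^ 'm) \<Rightarrow> 'a \<Rightarrow> real ^ 'm" where
  "anti_orthotomic_gauss P f x = (f x - P) /\<^sub>R norm (f x - P)"

end

theory Submission
  imports Defs
begin

text \<open>
  All three conditions say that a linear map on the tangent space at \<open>x\<^sub>0\<close> is injective, and in fact
  the three kernels coincide. Write \<open>g = f - P\<close>, \<open>u = df(v)\<close>, \<open>w = d\<nu>(v)\<close>; then \<open>u\<close> and \<open>w\<close> are orthogonal
  to \<open>\<nu>\<close>, while \<open>g\<close> is not. If \<open>u = 0\<close>, then the component of \<open>df'(v)\<close> orthogonal to \<open>\<nu>\<close> is a nonzero
  multiple of \<open>w\<close>, so \<open>df'(v) = 0\<close> iff \<open>w = 0\<close>. Moreover, \<open>d\<nu>'(v) = 0\<close> forces \<open>u\<close> to be a multiple of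
  \<open>g\<close>, hence \<open>u = 0\<close>.
\<close>

subsection \<open>Calculus of smooth maps\<close>

lemma Ck_on_subset: "Ck_on k f S \<Longrightarrow> T \<subseteq> S \<Longrightarrow> Ck_on k f T"
  by (induction k arbitrary: f) (auto intro: continuous_on_subset)

lemma Cinf_on_subset: "Cinf_on f S \<Longrightarrow> T \<subseteq> S \<Longrightarrow> Cinf_on f T"
  using Ck_on_subset unfolding Cinf_on_def by blast

lemma Cinf_on_imp_differentiable: "Cinf_on f S \<Longrightarrow> x \<in> S \<Longrightarrow> f differentiable (at x)"
  unfolding Cinf_on_def by (metis Ck_on.simps(2))

lemma Cinf_on_imp_continuous_on: "Cinf_on f S \<Longrightarrow> continuous_on S f"
  unfolding Cinf_on_def by (metis Ck_on.simps(1))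

text \<open>\<open>frechet_derivative\<close> at a point depends only on a neighbourhood of it, so
  functions that agree on an open set also have equal directional derivatives there, and the
  induction goes through.\<close>

lemma Ck_on_cong:
  assumes S: "open S" and eq: "\<And>x. x \<in> S \<Longrightarrow> f x = g x" and f: "Ck_on k f S"
  shows "Ck_on k g S"
  using eq f
proof (induction k arbitrary: f g)
  case 0
  then show ?case
    using continuous_on_cong[of S S f g] by simp
next
  case (Suc k)
  have "g differentiable (at x)" if "x \<in> S" for x
    using Suc.prems that has_derivative_transform_within_open[OF _ S that]
    unfolding differentiable_def Ck_on.simps by blast
  moreover have "Ck_on k (\<lambda>x. frechet_derivative g (at x) v) S" for v
  proof (rule Suc.IH)
    show "frechet_derivative f (at x) v = frechet_derivative g (at x) v" if "x \<in> S" for x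
      using Suc.prems that S frechet_derivative_transform_within_open[of f x S g] by auto
    show "Ck_on k (\<lambda>x. frechet_derivative f (at x) v) S"
      using Suc.prems by auto
  qed
  ultimately show ?case
    by auto
qed

text \<open>The introduction rule for all closure proofs below: it replaces
  \<open>frechet_derivative\<close> by a derivative \<open>D\<close> in closed form, which need
  agree with it only on \<open>S\<close>.\<close>

lemma Ck_on_SucI:
  assumes S: "open S" and D: "\<And>x. x \<in> S \<Longrightarrow> (f has_derivative D x) (at x)"
    and k: "\<And>v. Ck_on k (\<lambda>x. D x v) S"
  shows "Ck_on (Suc k) f S"
  using D Ck_on_cong[OF S _ k] frechet_derivative_at[OF D] by (auto simp: differentiable_def)

lemma Ck_on_Suc_has_derivative:
  "Ck_on (Suc k) f S \<Longrightarrow> x \<in> S \<Longrightarrow> (f has_derivative frechet_derivative f (at x)) (at x)"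
  by (simp add: frechet_derivative_works)

text \<open>\<open>Ck_on\<close> mentions continuity only at the last order, so lowering the order
  takes an induction whose base is that differentiability implies continuity. The product rule needs
  this for its undifferentiated factors.\<close>

lemma Ck_on_SucD: "Ck_on (Suc k) f S \<Longrightarrow> Ck_on k f S"
proof (induction k arbitrary: f)
  case 0
  then show ?case
    by (auto intro!: differentiable_imp_continuous_within continuous_at_imp_continuous_on)
next
  case (Suc k)
  have "Ck_on k (\<lambda>x. frechet_derivative f (at x) v) S" for v
    using Suc.prems Suc.IH unfolding Ck_on.simps(2)[of "Suc k"] by blast
  with Suc.prems show ?case
    by simp
qed

lemma Ck_on_const: "open S \<Longrightarrow> Ck_on k (\<lambda>x. c) S"
  by (induction k arbitrary: c) (auto intro!: Ck_on_SucI[of S _ "\<lambda>x v. 0"] simp del: Ck_on.simps(2))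

lemma Ck_on_add:
  assumes S: "open S"
  shows "Ck_on k f S \<Longrightarrow> Ck_on k g S \<Longrightarrow> Ck_on k (\<lambda>x. f x + g x) S"
proof (induction k arbitrary: f g)
  case (Suc k)
  note D = Suc.prems[THEN Ck_on_Suc_has_derivative]
  show ?case
    by (rule Ck_on_SucI[OF S has_derivative_add[OF D]])
      (use Suc in auto)
qed (auto intro: continuous_on_add)

text \<open>By the Leibniz rule each directional derivative is a sum of two products of the same
  kind, to which the induction hypothesis applies. One proof covers multiplication, inner product
  and scaling.\<close>

lemma (in bounded_bilinear) Ck_on:
  assumes S: "open S"
  shows "Ck_on k f S \<Longrightarrow> Ck_on k g S \<Longrightarrow> Ck_on k (\<lambda>x. prod (f x) (g x)) S"
proof (induction k arbitrary: f g)
  case (Suc k)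
  note D = Suc.prems[THEN Ck_on_Suc_has_derivative]
  show ?case
  proof (rule Ck_on_SucI[OF S FDERIV[OF D]])
    show "Ck_on k (\<lambda>x. prod (f x) (frechet_derivative g (at x) v) +
        prod (frechet_derivative f (at x) v) (g x)) S" for v
      by (intro Ck_on_add S Suc.IH Suc.prems[THEN Ck_on_SucD]) (use Suc.prems in auto)
  qed
qed (auto intro: continuous_on)

lemma Ck_on_diff:
  assumes S: "open S" and f: "Ck_on k f S" and g: "Ck_on k g S"
  shows "Ck_on k (\<lambda>x. f x - g x) S"
proof -
  have "Ck_on k (\<lambda>x. f x + (- 1) *\<^sub>R g x) S"
    by (intro Ck_on_add bounded_bilinear.Ck_on[OF bounded_bilinear_scaleR] Ck_on_const S f g)
  then show ?thesis
    by simp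
qed

lemma Ck_on_Pair:
  assumes S: "open S"
  shows "Ck_on k f S \<Longrightarrow> Ck_on k g S \<Longrightarrow> Ck_on k (\<lambda>x. (f x, g x)) S"
proof (induction k arbitrary: f g)
  case (Suc k)
  note D = Suc.prems[THEN Ck_on_Suc_has_derivative]
  show ?case
    by (rule Ck_on_SucI[OF S has_derivative_Pair[OF D]])
      (use Suc in auto)
qed (auto intro: continuous_on_Pair)

text \<open>The derivative of \<open>inverse (f x)\<close> contains \<open>inverse (f x)\<close>
  itself, but only its smoothness of order \<open>k\<close> is needed there, so the induction
  closes.\<close>

lemma Ck_on_inverse:
  fixes f :: "'a::real_normed_vector \<Rightarrow> real"
  assumes S: "open S" and f0: "\<And>x. x \<in> S \<Longrightarrow> f x \<noteq> 0"
  shows "Ck_on k f S \<Longrightarrow> Ck_on k (\<lambda>x. inverse (f x)) S"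
proof (induction k)
  case (Suc k)
  note D = Suc.prems[THEN Ck_on_Suc_has_derivative]
  have IH: "Ck_on k (\<lambda>x. inverse (f x)) S"
    using Suc.IH Ck_on_SucD[OF Suc.prems] .
  show ?case
  proof (rule Ck_on_SucI[OF S Deriv.has_derivative_inverse[OF f0 D]])
    have "Ck_on k (\<lambda>x. - 1 * (inverse (f x) * frechet_derivative f (at x) v * inverse (f x))) S" for v
      by (intro bounded_bilinear.Ck_on[OF bounded_bilinear_mult] S IH Ck_on_const)
        (use Suc.prems in auto)
    then show "Ck_on k (\<lambda>x. - (inverse (f x) * frechet_derivative f (at x) v * inverse (f x))) S" for v
      by simp
  qed
qed (use f0 in \<open>auto intro: continuous_on_inverse\<close>)

text \<open>The same bootstrapping as for \<open>inverse\<close>: the derivative is a directional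
  derivative of \<open>f\<close> times \<open>inverse (2 * sqrt (f x))\<close>, which is of class
  \<open>k\<close> by induction.\<close>

lemma Ck_on_sqrt:
  assumes S: "open S" and f0: "\<And>x. x \<in> S \<Longrightarrow> 0 < f x"
  shows "Ck_on k f S \<Longrightarrow> Ck_on k (\<lambda>x. sqrt (f x)) S"
proof (induction k)
  case (Suc k)
  note D = Suc.prems[THEN Ck_on_Suc_has_derivative]
  have IH: "Ck_on k (\<lambda>x. inverse (2 * sqrt (f x))) S"
    using f0 by (intro Ck_on_inverse S bounded_bilinear.Ck_on[OF bounded_bilinear_mult] Ck_on_const
        Suc.IH Ck_on_SucD[OF Suc.prems]) fastforce
  show ?case
  proof (rule Ck_on_SucI[OF S])
    show "((\<lambda>x. sqrt (f x)) has_derivative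
        (\<lambda>v. frechet_derivative f (at x) v * inverse (2 * sqrt (f x)))) (at x)" if "x \<in> S" for x
      using has_derivative_real_sqrt[OF f0 D, OF that that] by (simp add: field_simps)
    show "Ck_on k (\<lambda>x. frechet_derivative f (at x) v * inverse (2 * sqrt (f x))) S" for v
      by (intro bounded_bilinear.Ck_on[OF bounded_bilinear_mult] S IH)
        (use Suc.prems in auto)
  qed
qed (auto intro: continuous_on_real_sqrt)

lemma Cinf_on_Pair:
  "open S \<Longrightarrow> Cinf_on f S \<Longrightarrow> Cinf_on g S \<Longrightarrow> Cinf_on (\<lambda>x. (f x, g x)) S"
  by (simp add: Cinf_on_def Ck_on_Pair)

subsection \<open>Anti-orthotomics of maps between vector spaces\<close>

lemma Cinf_on_anti_orthotomic:
  assumes S: "open S" and f: "Cinf_on f S" and \<nu>: "Cinf_on \<nu> S"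
    and nz: "\<And>x. x \<in> S \<Longrightarrow> (f x - P) \<bullet> \<nu> x \<noteq> 0"
  shows "Cinf_on (anti_orthotomic P f \<nu>) S"
proof -
  have eq: "anti_orthotomic P f \<nu> = (\<lambda>x. f x -
      ((f x - P) \<bullet> (f x - P) * inverse (2 * ((f x - P) \<bullet> \<nu> x))) *\<^sub>R \<nu> x)"
    by (simp only: fun_eq_iff anti_orthotomic_def power2_norm_eq_inner divide_inverse simp_thms)
  show ?thesis
    unfolding Cinf_on_def eq
    by (intro allI Ck_on_diff Ck_on_inverse Ck_on_const S f[unfolded Cinf_on_def, rule_format]
        \<nu>[unfolded Cinf_on_def, rule_format]
        bounded_bilinear.Ck_on[OF bounded_bilinear_mult]
        bounded_bilinear.Ck_on[OF bounded_bilinear_inner]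
        bounded_bilinear.Ck_on[OF bounded_bilinear_scaleR]) (use nz in simp)
qed

lemma Cinf_on_anti_orthotomic_gauss:
  assumes S: "open S" and f: "Cinf_on f S" and nz: "\<And>x. x \<in> S \<Longrightarrow> f x \<noteq> P"
  shows "Cinf_on (anti_orthotomic_gauss P f) S"
proof -
  \<comment> \<open>Written through \<open>sqrt\<close> of an inner product, the norm is smooth
    because its argument stays positive when \<open>f x \<noteq> P\<close>.\<close>
  have eq: "anti_orthotomic_gauss P f =
      (\<lambda>x. inverse (sqrt ((f x - P) \<bullet> (f x - P))) *\<^sub>R (f x - P))"
    by (simp only: fun_eq_iff anti_orthotomic_gauss_def norm_eq_sqrt_inner simp_thms)
  show ?thesis
    unfolding Cinf_on_def eq
    by (intro allI Ck_on_diff Ck_on_inverse Ck_on_const Ck_on_sqrt S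
        f[unfolded Cinf_on_def, rule_format]
        bounded_bilinear.Ck_on[OF bounded_bilinear_inner]
        bounded_bilinear.Ck_on[OF bounded_bilinear_scaleR]) (use nz in simp_all)
qed

text \<open>The derivative of \<open>g - (g \<bullet> g / (2 * (g \<bullet> n))) *\<^sub>R n\<close> when \<open>g\<close> and \<open>n\<close> have derivatives \<open>u\<close> and \<open>w\<close>,
  already simplified by \<open>u \<bullet> n = 0\<close>.\<close>

definition anti_orthotomic_derivative ::
  "real ^ 'm \<Rightarrow> real ^ 'm \<Rightarrow> real ^ 'm \<Rightarrow> real ^ 'm \<Rightarrow> real ^ 'm" where
  "anti_orthotomic_derivative g n u w = u -
     ((g \<bullet> g / (2 * (g \<bullet> n))) *\<^sub>R w +
      ((g \<bullet> u) / (g \<bullet> n) - (g \<bullet> g) * (g \<bullet> w) / (2 * (g \<bullet> n)\<^sup>2)) *\<^sub>R n)"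

lemma has_derivative_anti_orthotomic:
  assumes f: "(f has_derivative f') (at x)" and \<nu>: "(\<nu> has_derivative \<nu>') (at x)"
    and nz: "(f x - P) \<bullet> \<nu> x \<noteq> 0" and tangent: "\<And>v. f' v \<bullet> \<nu> x = 0"
  shows "(anti_orthotomic P f \<nu> has_derivative
    (\<lambda>v. anti_orthotomic_derivative (f x - P) (\<nu> x) (f' v) (\<nu>' v))) (at x)"
proof -
  have g: "((\<lambda>x. f x - P) has_derivative f') (at x)"
    using has_derivative_diff[OF f has_derivative_const[of P]] by simp
  let ?l = "\<lambda>x. ((f x - P) \<bullet> (f x - P)) / (2 * ((f x - P) \<bullet> \<nu> x))"
  have eq: "anti_orthotomic P f \<nu> = (\<lambda>x. f x - ?l x *\<^sub>R \<nu> x)"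
    by (simp only: fun_eq_iff anti_orthotomic_def power2_norm_eq_inner simp_thms)
  have "(?l has_derivative (\<lambda>v. ((f x - P) \<bullet> f' v) / ((f x - P) \<bullet> \<nu> x) -
      ((f x - P) \<bullet> (f x - P)) * ((f x - P) \<bullet> \<nu>' v) / (2 * ((f x - P) \<bullet> \<nu> x)\<^sup>2))) (at x)"
  proof (rule has_derivative_eq_rhs[OF has_derivative_divide'])
    show "((\<lambda>x. (f x - P) \<bullet> (f x - P)) has_derivative (\<lambda>v. 2 * ((f x - P) \<bullet> f' v))) (at x)"
      using has_derivative_inner[OF g g] by (simp add: inner_commute)
    \<comment> \<open>Tangency removes the summand \<open>f' v \<bullet> \<nu> x\<close>, so the
      denominator varies only through the normal.\<close>
    show "((\<lambda>x. 2 * ((f x - P) \<bullet> \<nu> x)) has_derivative (\<lambda>v. 2 * ((f x - P) \<bullet> \<nu>' v))) (at x)"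
      using has_derivative_mult_right[OF has_derivative_inner[OF g \<nu>], of 2] tangent by simp
  qed (use nz in \<open>auto simp: fun_eq_iff field_simps power2_eq_square\<close>)
  from has_derivative_diff[OF f has_derivative_scaleR[OF this \<nu>]]
  show ?thesis
    by (simp add: eq anti_orthotomic_derivative_def)
qed

lemma has_derivative_anti_orthotomic_gauss:
  assumes f: "(f has_derivative f') (at x)" and nz: "f x \<noteq> P"
  shows "(anti_orthotomic_gauss P f has_derivative (\<lambda>v. f' v /\<^sub>R norm (f x - P) -
    (((f x - P) \<bullet> f' v) / norm (f x - P) ^ 3) *\<^sub>R (f x - P))) (at x)"
proof -
  have g: "((\<lambda>x. f x - P) has_derivative f') (at x)"
    using has_derivative_diff[OF f has_derivative_const[of P]] by simp
  \<comment> \<open>The derivative of the norm is the pairing with \<open>sgn (f x - P)\<close>; the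
    inverse contributes two more factors of the norm, hence the cube.\<close>
  have "((\<lambda>x. inverse (norm (f x - P))) has_derivative
      (\<lambda>v. - (((f x - P) \<bullet> f' v) / norm (f x - P) ^ 3))) (at x)"
  proof (rule has_derivative_eq_rhs[OF Deriv.has_derivative_inverse[OF _ has_derivative_compose[OF g has_derivative_norm]]])
  qed (use nz in \<open>auto simp: sgn_div_norm fun_eq_iff divide_simps inner_commute power3_eq_cube\<close>)
  from has_derivative_scaleR[OF this g]
  show ?thesis
    by (simp add: anti_orthotomic_gauss_def[abs_def])
qed

text \<open>In the pairing with \<open>g\<close>, the coefficient of \<open>n\<close> produces
  exactly the terms that cancel those of \<open>u\<close> and \<open>w\<close>. This is why the
  direction of \<open>f - P\<close> serves as Gauss mapping of the anti-orthotomic.\<close>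

lemma anti_orthotomic_derivative_orthogonal:
  assumes "g \<bullet> n \<noteq> 0"
  shows "anti_orthotomic_derivative g n u w \<bullet> g = 0"
  using assms by (simp add: anti_orthotomic_derivative_def inner_simps field_simps power2_eq_square
      inner_commute)

lemma anti_orthotomic_derivative_eq_0:
  assumes "g \<bullet> n \<noteq> 0" "w \<bullet> n = 0" and eq: "anti_orthotomic_derivative g n 0 w = 0"
  shows "w = 0"
proof -
  define b where "b = (g \<bullet> g) * (g \<bullet> w) / (2 * (g \<bullet> n)\<^sup>2)"
  have e: "(g \<bullet> g / (2 * (g \<bullet> n))) *\<^sub>R w = b *\<^sub>R n"
    using eq by (simp add: anti_orthotomic_derivative_def b_def)
  have "b * (n \<bullet> n) = (g \<bullet> g / (2 * (g \<bullet> n))) * (w \<bullet> n)"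
    using arg_cong[OF e, of "\<lambda>z. z \<bullet> n"] by simp
  \<comment> \<open>Pairing with \<open>n\<close> has killed \<open>w\<close>, so
    \<open>b * (n \<bullet> n) = 0\<close>, and hence \<open>b\<close> or \<open>n\<close>
    vanishes.\<close>
  with assms have "b *\<^sub>R n = 0"
    by auto
  \<comment> \<open>The coefficient of \<open>w\<close> is nonzero, since
    \<open>g \<bullet> n \<noteq> 0\<close> forces \<open>g \<noteq> 0\<close>.\<close>
  with e assms(1) show ?thesis
    by auto
qed

text \<open>An infinitesimal motion of \<open>g\<close> that fixes its direction is radial, hence transversal to the
  tangent hyperplane \<open>n\<^sup>\<bottom>\<close>.\<close>

lemma normalized_derivative_eq_0:
  fixes g n u :: "'a::real_inner"
  assumes "g \<bullet> n \<noteq> 0" "u \<bullet> n = 0" and eq: "u /\<^sub>R norm g - ((g \<bullet> u) / norm g ^ 3) *\<^sub>R g = 0"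
  shows "u = 0"
proof -
  have "((g \<bullet> u) / norm g ^ 3) * (g \<bullet> n) = 0"
    using arg_cong[OF eq, of "\<lambda>z. z \<bullet> n"] assms(2) by (simp only: inner_simps) simp
  with assms(1) have "(g \<bullet> u) / norm g ^ 3 = 0"
    by simp
  with eq have "u /\<^sub>R norm g = 0"
    by (simp only: scaleR_zero_left diff_0_right)
  with assms(1) show ?thesis
    by auto
qed

subsection \<open>Germs on manifolds\<close>

lemma smooth_map_on_subset: "smooth_map_on A U g \<Longrightarrow> V \<subseteq> U \<Longrightarrow> smooth_map_on A V g"
  unfolding smooth_map_on_def by (meson Cinf_on_subset Int_mono image_mono order_refl)

lemma smooth_map_on_Pair:
  assumes M: "smooth_manifold X A" and U: "openin X U"
    and g: "smooth_map_on A U g" and h: "smooth_map_on A U h"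
  shows "smooth_map_on A U (\<lambda>x. (g x, h x))"
  unfolding smooth_map_on_def
proof
  fix c assume c: "c \<in> A"
  then have "is_chart X c"
    using M by (simp add: smooth_manifold_def)
  then have S: "open (coords c ` (chart_dom c \<inter> U))"
    using U by (rule open_coords_image)
  have "(\<lambda>x. (g x, h x)) \<circ> param c = (\<lambda>y. ((g \<circ> param c) y, (h \<circ> param c) y))"
    by (simp add: fun_eq_iff)
  moreover have "Cinf_on (\<lambda>y. ((g \<circ> param c) y, (h \<circ> param c) y)) (coords c ` (chart_dom c \<inter> U))"
    using g h c unfolding smooth_map_on_def by (intro Cinf_on_Pair S) (erule bspec, assumption)+
  ultimately show "Cinf_on ((\<lambda>x. (g x, h x)) \<circ> param c) (coords c ` (chart_dom c \<inter> U))"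
    by (simp only:)
qed

lemma smooth_map_on_imp_differentiable:
  "smooth_map_on A U g \<Longrightarrow> x \<in> U \<Longrightarrow> c \<in> charts_at A x \<Longrightarrow>
    (g \<circ> param c) differentiable (at (coords c x))"
  by (rule Cinf_on_imp_differentiable[of _ "coords c ` (chart_dom c \<inter> U)"])
    (auto simp: smooth_map_on_def charts_at_def)

lemma differential_eq_smooth_map_on:
  assumes "smooth_manifold X A" "smooth_map_on A U g" "x \<in> U" "c \<in> charts_at A x"
    "v \<in> tangent_space A x"
  shows "differential A g x v = frechet_derivative (g \<circ> param c) (at (coords c x)) (v c)"
  using assms smooth_map_on_imp_differentiable differential_eq by metis

text \<open>A nonzero kernel vector \<open>w\<close> allows every argument to be moved along
  \<open>w\<close> into the hyperplane orthogonal to \<open>w\<close> without changing its image, so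
  the rank drops below \<open>DIM('a)\<close>.\<close>

lemma dim_range_eq_iff_inj:
  fixes D :: "'a::euclidean_space \<Rightarrow> 'b::euclidean_space"
  assumes lin: "linear D"
  shows "dim (range D) = DIM('a) \<longleftrightarrow> inj D"
proof
  assume dim: "dim (range D) = DIM('a)"
  show "inj D"
    unfolding linear_injective_0[OF lin]
  proof (rule allI, rule impI, rule ccontr)
    fix w assume w: "D w = 0" "w \<noteq> 0"
    have "range D \<subseteq> D ` {y. w \<bullet> y = 0}"
    proof clarify
      fix y
      \<comment> \<open>The orthogonal projection of \<open>y\<close> onto that hyperplane.\<close>
      let ?z = "y - ((w \<bullet> y) / (w \<bullet> w)) *\<^sub>R w"
      have "D y = D ?z"
        using w by (simp add: linear_diff[OF lin] linear_cmul[OF lin])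
      moreover have "?z \<in> {y. w \<bullet> y = 0}"
        using w by (simp add: inner_diff_right)
      ultimately show "D y \<in> D ` {y. w \<bullet> y = 0}"
        by (rule image_eqI)
    qed
    then have "dim (range D) \<le> dim {y. w \<bullet> y = 0}"
      by (rule order_trans[OF dim_subset dim_image_le[OF lin]])
    also have "\<dots> < DIM('a)"
      using dim_hyperplane[OF w(2)] by simp
    finally show False
      using dim by simp
  qed
qed (use dim_image_eq[OF lin, of UNIV] in simp)

text \<open>A chart identifies the tangent space with \<open>real ^ 'n\<close>, so the rank
  condition becomes triviality of the kernel of one coordinate derivative. All conditions of the
  theorem are compared in this form.\<close>

lemma nonsingular_germ_iff:
  fixes A :: "('a, 'n::finite) chart set" and g :: "'a \<Rightarrow> 'b::euclidean_space"
  assumes M: "smooth_manifold X A" and U: "openin X U" "x \<in> U" and g: "smooth_map_on A U g"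
    and c: "c \<in> charts_at A x"
  shows "nonsingular_germ X A g x \<longleftrightarrow>
    (\<forall>v. frechet_derivative (g \<circ> param c) (at (coords c x)) v = 0 \<longrightarrow> v = 0)"
proof -
  let ?D = "frechet_derivative (g \<circ> param c) (at (coords c x))"
  have lin: "linear ?D"
    using smooth_map_on_imp_differentiable[OF g U(2) c] by (rule linear_frechet_derivative)
  have "differential A g x ` tangent_space A x = ?D ` (\<lambda>v. v c) ` tangent_space A x"
    unfolding image_image
    by (rule image_cong[OF refl]) (rule differential_eq_smooth_map_on[OF M g U(2) c])
  also have "\<dots> = range ?D"
    using bij_betw_tangent_space[OF M c] by (simp add: bij_betw_def)
  finally have "nonsingular_germ X A g x \<longleftrightarrow> dim (range ?D) = CARD('n)"
    using U g by (auto simp: nonsingular_germ_def smooth_germ_def)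
  also have "\<dots> \<longleftrightarrow> inj ?D"
    using dim_range_eq_iff_inj[OF lin] by simp
  also have "\<dots> \<longleftrightarrow> (\<forall>v. ?D v = 0 \<longrightarrow> v = 0)"
    using lin by (rule linear_injective_0)
  finally show ?thesis .
qed

text \<open>Smoothness is given in coordinates only, so openness is checked around each point: pull
  \<open>T\<close> back to the coordinate image, then through \<open>coords c\<close> to the chart
  domain, which is open in \<open>X\<close>.\<close>

lemma openin_smooth_preimage:
  fixes A :: "('a, 'n::finite) chart set" and g :: "'a \<Rightarrow> 'b::real_normed_vector"
  assumes M: "smooth_manifold X A" and g: "smooth_map_on A (topspace X) g" and T: "open T"
  shows "openin X {x \<in> topspace X. g x \<in> T}"
proof (subst openin_subopen, safe)
  fix x assume x: "x \<in> topspace X" "g x \<in> T"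
  then obtain c where c: "c \<in> A" "x \<in> chart_dom c"
    using M unfolding smooth_manifold_def by blast
  have ch: "is_chart X c"
    using M c by (auto simp: smooth_manifold_def)
  then have op: "openin X (chart_dom c)" "open (coords c ` chart_dom c)"
    and hom: "continuous_map (subtopology X (chart_dom c)) (top_of_set (coords c ` chart_dom c)) (coords c)"
    unfolding is_chart_def using homeomorphic_imp_continuous_map by blast+
  have sub: "chart_dom c \<subseteq> topspace X"
    using op(1) openin_subset by blast
  define V where "V = (g \<circ> param c) -` T \<inter> coords c ` chart_dom c"
  have "Cinf_on (g \<circ> param c) (coords c ` chart_dom c)"
    using g c sub by (auto simp: smooth_map_on_def Int_absorb2)
  from continuous_openin_preimage_gen[OF Cinf_on_imp_continuous_on[OF this] T]
  have "openin (top_of_set (coords c ` chart_dom c)) V"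
    by (simp only: V_def Int_commute)
  from openin_continuous_map_preimage[OF hom this]
  have "openin X {y \<in> topspace (subtopology X (chart_dom c)). coords c y \<in> V}"
    using op(1) by (rule openin_trans_full)
  also have "{y \<in> topspace (subtopology X (chart_dom c)). coords c y \<in> V} =
      {y \<in> chart_dom c. coords c y \<in> V}"
    using sub by auto
  also have "\<dots> = {y \<in> chart_dom c. g y \<in> T}"
    unfolding V_def by (rule Collect_cong, rule conj_cong[OF refl]) (simp add: param_coords[OF ch])
  finally show "\<exists>S. openin X S \<and> x \<in> S \<and> S \<subseteq> {x \<in> topspace X. g x \<in> T}"
    using x c sub by blast
qed

text \<open>Differentiate the constant function \<open>g y \<bullet> g y = 1\<close>.\<close>

lemma sphere_derivative_orthogonal:
  fixes g :: "'a::real_normed_vector \<Rightarrow> 'b::real_inner"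
  assumes S: "open S" "x \<in> S" and g: "(g has_derivative g') (at x)"
    and sph: "\<And>y. y \<in> S \<Longrightarrow> g y \<in> sphere 0 1"
  shows "g' v \<bullet> g x = 0"
proof -
  have "((\<lambda>y. g y \<bullet> g y) has_derivative (\<lambda>v. g x \<bullet> g' v + g' v \<bullet> g x)) (at x)"
    by (rule has_derivative_inner[OF g g])
  moreover have "((\<lambda>y. g y \<bullet> g y) has_derivative (\<lambda>v. 0)) (at x)"
    by (rule has_derivative_transform_within_open[OF has_derivative_const[of 1] S])
      (use sph in \<open>auto simp: dot_square_norm\<close>)
  ultimately have "(\<lambda>v. g x \<bullet> g' v + g' v \<bullet> g x) = (\<lambda>v. 0)"
    by (rule has_derivative_unique)
  then have "g x \<bullet> g' v + g' v \<bullet> g x = 0"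
    by metis
  then show ?thesis
    by (simp add: inner_commute)
qed

theorem theorem5:
  fixes N :: "'a topology" and A :: "('a, 'n::finite) chart set"
    and f \<nu> :: "'a \<Rightarrow> real ^ 'm" and x\<^sub>0 :: 'a and P :: "real ^ 'm"
  assumes "CARD('m) = CARD('n) + 1"
    and "smooth_manifold N A"
    and "frontal N A f \<nu>"
    and "x\<^sub>0 \<in> topspace N"
    and "(f x\<^sub>0 - P) \<bullet> \<nu> x\<^sub>0 \<noteq> 0"
  defines "f' \<equiv> anti_orthotomic P f \<nu>"
    and "\<nu>' \<equiv> anti_orthotomic_gauss P f"
  shows "(front_germ N A f \<nu> x\<^sub>0 \<longleftrightarrow> front_germ N A f' \<nu>' x\<^sub>0) \<and>
         (front_germ N A f' \<nu>' x\<^sub>0 \<longleftrightarrow> nonsingular_germ N A (\<lambda>x. (f x, f' x)) x\<^sub>0)"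
proof -
  note M = \<open>smooth_manifold N A\<close>
  have f0: "smooth_map_on A (topspace N) f" and \<nu>0: "smooth_map_on A (topspace N) \<nu>"
    and sph: "\<And>x. x \<in> topspace N \<Longrightarrow> \<nu> x \<in> sphere 0 1"
    and tan: "\<And>x v. x \<in> topspace N \<Longrightarrow> v \<in> tangent_space A x \<Longrightarrow> differential A f x v \<bullet> \<nu> x = 0"
    using \<open>frontal N A f \<nu>\<close> by (simp_all add: frontal_def frontal_on_def)
  have chart: "is_chart N c" if "c \<in> A" for c
    using M that by (simp add: smooth_manifold_def)
  have open_chart: "open (coords c ` (chart_dom c \<inter> W))" if "c \<in> A" "openin N W" for c W
    using open_coords_image[OF chart] that by blast
  have pc: "param c (coords c x) = x" if "c \<in> A" "x \<in> chart_dom c" for c x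
    using param_coords[OF chart] that by blast
  have ex_chart: "\<exists>c. c \<in> charts_at A x" if "x \<in> topspace N" for x
    using M that unfolding smooth_manifold_def charts_at_def by blast
  \<comment> \<open>The anti-orthotomic formulas are smooth on \<open>U\<close>. As \<open>U\<close>
    is open and contains \<open>x\<^sub>0\<close>, it carries representatives of all the
    germs.\<close>
  define U where "U = {x \<in> topspace N. (f x - P) \<bullet> \<nu> x \<noteq> 0}"
  have U: "openin N U"
  proof -
    have "open {p :: (real ^ 'm) \<times> (real ^ 'm). (fst p - P) \<bullet> snd p \<noteq> 0}"
      by (intro open_Collect_neq continuous_intros)
    from openin_smooth_preimage[OF M smooth_map_on_Pair[OF M openin_topspace f0 \<nu>0] this]
    show ?thesis
      by (simp add: U_def)
  qed
  have x0: "x\<^sub>0 \<in> U"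
    using assms by (simp add: U_def)
  have nz: "(f x - P) \<bullet> \<nu> x \<noteq> 0" "f x \<noteq> P" and UN: "x \<in> topspace N" if "x \<in> U" for x
    using that unfolding U_def by fastforce+
  have smooth: "smooth_map_on A U f" "smooth_map_on A U \<nu>"
    by (rule smooth_map_on_subset[OF f0] smooth_map_on_subset[OF \<nu>0], use UN in blast)+
  \<comment> \<open>The constructions are pointwise, so reading them in a chart commutes with
    applying them and the vector space results apply.\<close>
  have f'_chart: "f' \<circ> param c = anti_orthotomic P (f \<circ> param c) (\<nu> \<circ> param c)"
    and \<nu>'_chart: "\<nu>' \<circ> param c = anti_orthotomic_gauss P (f \<circ> param c)" for c :: "('a, 'n) chart"
    by (auto simp: fun_eq_iff f'_def \<nu>'_def anti_orthotomic_def anti_orthotomic_gauss_def)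
  have smooth': "smooth_map_on A U f'" "smooth_map_on A U \<nu>'"
    unfolding smooth_map_on_def f'_chart \<nu>'_chart
  proof (safe)
    fix c assume c: "c \<in> A"
    let ?S = "coords c ` (chart_dom c \<inter> U)"
    have F: "Cinf_on (f \<circ> param c) ?S" and G: "Cinf_on (\<nu> \<circ> param c) ?S"
      using smooth c by (simp_all add: smooth_map_on_def)
    have "((f \<circ> param c) y - P) \<bullet> (\<nu> \<circ> param c) y \<noteq> 0 \<and> (f \<circ> param c) y \<noteq> P" if "y \<in> ?S" for y
    proof -
      obtain x where "x \<in> U" "param c y = x"
        using \<open>y \<in> ?S\<close> pc[OF c] by auto
      then show ?thesis
        using nz by simp
    qed
    then show "Cinf_on (anti_orthotomic P (f \<circ> param c) (\<nu> \<circ> param c)) ?S"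
      and "Cinf_on (anti_orthotomic_gauss P (f \<circ> param c)) ?S"
      using Cinf_on_anti_orthotomic[OF open_chart[OF c U] F G]
        Cinf_on_anti_orthotomic_gauss[OF open_chart[OF c U] F] by blast+
  qed

  let ?D = "\<lambda>g c x. frechet_derivative (g \<circ> param c) (at (coords c x))"
  have D: "(g \<circ> param c has_derivative ?D g c x) (at (coords c x))"
    if "smooth_map_on A U g" "x \<in> U" "c \<in> charts_at A x"
    for x c and g :: "'a \<Rightarrow> real ^ 'm"
    using smooth_map_on_imp_differentiable[OF that] by (simp only: frechet_derivative_works)
  have Df_orth: "?D f c x v \<bullet> \<nu> x = 0" if x: "x \<in> U" and c: "c \<in> charts_at A x" for x c v
  proof -
    \<comment> \<open>The frontal condition speaks of abstract tangent vectors; every coordinate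
      vector comes from one.\<close>
    obtain w where w: "w \<in> tangent_space A x" "w c = v"
      using bij_betw_imp_surj_on[OF bij_betw_tangent_space[OF M c]]
      by (metis (no_types, lifting) UNIV_I imageE)
    then show ?thesis
      using tan[OF UN[OF x] w(1)] differential_eq_smooth_map_on[OF M smooth(1) x c w(1)] by simp
  qed
  have D\<nu>_orth: "?D \<nu> c x v \<bullet> \<nu> x = 0" if x: "x \<in> U" and c: "c \<in> charts_at A x" for x c v
  proof -
    have cA: "c \<in> A" "x \<in> chart_dom c"
      using c by (auto simp: charts_at_def)
    have "?D \<nu> c x v \<bullet> (\<nu> \<circ> param c) (coords c x) = 0"
      by (rule sphere_derivative_orthogonal[OF open_chart[OF cA(1) U] _ D[OF smooth(2) x c]])
        (use x cA(2) sph UN pc[OF cA(1)] in auto)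
    with pc[OF cA] show ?thesis
      by simp
  qed
  have Df': "?D f' c x v = anti_orthotomic_derivative (f x - P) (\<nu> x) (?D f c x v) (?D \<nu> c x v)"
    and D\<nu>': "?D \<nu>' c x v = ?D f c x v /\<^sub>R norm (f x - P) -
      (((f x - P) \<bullet> ?D f c x v) / norm (f x - P) ^ 3) *\<^sub>R (f x - P)"
    if x: "x \<in> U" and c: "c \<in> charts_at A x" for x c v
  proof -
    have pcx: "(f \<circ> param c) (coords c x) = f x" "(\<nu> \<circ> param c) (coords c x) = \<nu> x"
      using c pc by (simp_all add: charts_at_def)
    show "?D f' c x v = anti_orthotomic_derivative (f x - P) (\<nu> x) (?D f c x v) (?D \<nu> c x v)"
      unfolding f'_chart frechet_derivative_at[OF has_derivative_anti_orthotomic[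
          OF D[OF smooth(1) x c] D[OF smooth(2) x c], unfolded pcx, OF nz(1)[OF x] Df_orth[OF x c]], symmetric]
      by (rule refl)
    show "?D \<nu>' c x v = ?D f c x v /\<^sub>R norm (f x - P) -
      (((f x - P) \<bullet> ?D f c x v) / norm (f x - P) ^ 3) *\<^sub>R (f x - P)"
      unfolding \<nu>'_chart frechet_derivative_at[OF has_derivative_anti_orthotomic_gauss[
          OF D[OF smooth(1) x c], unfolded pcx, OF nz(2)[OF x]], symmetric]
      by (rule refl)
  qed

  \<comment> \<open>This holds whether or not \<open>(f, \<nu>)\<close> is a front, so being a
    front-germ reduces to non-singularity for both pairs.\<close>
  have "frontal_on A U f' \<nu>'"
    unfolding frontal_on_def
  proof (intro conjI ballI smooth')
    fix x assume x: "x \<in> U"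
    show "\<nu>' x \<in> sphere 0 1"
      using nz[OF x] by (simp add: \<nu>'_def anti_orthotomic_gauss_def)
    fix v assume v: "v \<in> tangent_space A x"
    obtain c where c: "c \<in> charts_at A x"
      using UN[OF x] ex_chart by blast
    show "differential A f' x v \<bullet> \<nu>' x = 0"
      using anti_orthotomic_derivative_orthogonal[OF nz(1)[OF x]]
      by (simp add: differential_eq_smooth_map_on[OF M smooth'(1) x c v] Df'[OF x c]
          \<nu>'_def anti_orthotomic_gauss_def)
  qed
  then have fg': "frontal_germ N A f' \<nu>' x\<^sub>0"
    using U x0 unfolding frontal_germ_def by blast
  have fg: "frontal_germ N A f \<nu> x\<^sub>0"
    using \<open>frontal N A f \<nu>\<close> \<open>x\<^sub>0 \<in> topspace N\<close> unfolding frontal_germ_def frontal_def by blast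

  obtain c where c: "c \<in> charts_at A x\<^sub>0"
    using UN[OF x0] ex_chart by blast
  \<comment> \<open>The kernel for a pair is the intersection of the kernels of its
    components.\<close>
  have nonsing: "nonsingular_germ N A (\<lambda>x. (g x, h x)) x\<^sub>0 \<longleftrightarrow>
      (\<forall>v. ?D g c x\<^sub>0 v = 0 \<and> ?D h c x\<^sub>0 v = 0 \<longrightarrow> v = 0)"
    if g: "smooth_map_on A U g" and h: "smooth_map_on A U h" for g h :: "'a \<Rightarrow> real ^ 'm"
  proof -
    have "((\<lambda>x. (g x, h x)) \<circ> param c has_derivative (\<lambda>v. (?D g c x\<^sub>0 v, ?D h c x\<^sub>0 v))) (at (coords c x\<^sub>0))"
      using has_derivative_Pair[OF D[OF g x0 c] D[OF h x0 c]] by (simp add: o_def)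
    note DP = frechet_derivative_at[OF this, symmetric]
    show ?thesis
      unfolding nonsingular_germ_iff[OF M U x0 smooth_map_on_Pair[OF M U g h] c] DP
      by (simp add: zero_prod_def)
  qed
  note D' = Df'[OF x0 c] D\<nu>'[OF x0 c]
  \<comment> \<open>Once \<open>?D f\<close> vanishes on \<open>v\<close>, the derivative of
    \<open>f'\<close> depends on that of \<open>\<nu>\<close> alone, and each vanishes iff the other
    does.\<close>
  have ker: "?D f c x\<^sub>0 v = 0 \<and> ?D \<nu> c x\<^sub>0 v = 0 \<longleftrightarrow> ?D f c x\<^sub>0 v = 0 \<and> ?D f' c x\<^sub>0 v = 0" for v
    using anti_orthotomic_derivative_eq_0[OF nz(1)[OF x0] D\<nu>_orth[OF x0 c]]
    by (auto simp: D') (simp add: anti_orthotomic_derivative_def)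
  \<comment> \<open>Here the derivative of \<open>\<nu>'\<close> depends on \<open>?D f\<close>
    alone and has the same kernel: a radial vector orthogonal to \<open>\<nu> x\<^sub>0\<close> is
    zero.\<close>
  have ker': "?D f' c x\<^sub>0 v = 0 \<and> ?D \<nu>' c x\<^sub>0 v = 0 \<longleftrightarrow> ?D f c x\<^sub>0 v = 0 \<and> ?D f' c x\<^sub>0 v = 0" for v
    using normalized_derivative_eq_0[OF nz(1)[OF x0] Df_orth[OF x0 c]]
    by (auto simp: D')
  show ?thesis
    by (simp only: front_germ_def fg fg' nonsing smooth smooth' ker ker' simp_thms)
qed

end
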